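(* Let $p$ be a prime, let $G$ be a finite group and let $g$ be a $p$-element of $G$. Then $g\in L_\infty(G)$ if and only if $g^\alpha=g$ for every $p'$-element $\alpha$ of $\mathrm{Aut}\,G$.
   Context: All groups are finite. $\mathrm{Aut}\,G$ is the group of all automorphisms of $G$. A $p$-element is an element whose order is a power of $p$; a $p'$-element is an element whose order is coprime to $p$. For $x\in G$ and $\alpha\in\mathrm{Aut}\,G$, $x^\alpha$ denotes the image of $x$ under $\alpha$, $[x,\alpha]=x^{-1}x^\alpha$, and inductively $[x,\alpha_1,\dots,\alpha_n]=[[x,\alpha_1,\dots,\alpha_{n-1}],\alpha_n]$. For a natural number $n$ let $L_n(G)=\{x\in G \mid [x,\alpha_1,\dots,\alpha_n]=1 \text{ for all } \alpha_1,\dots,\alpha_n\in\mathrm{Aut}\,G\}$. One has $L_n(G)\subseteq L_{n+1}(G)$ for all $n$, and since $G$ is finite, $L_n(G)=L_{n+1}(G)$ for some $n$; for such $n$ put $L_\infty(G)=L_n(G)$ (the absolute hypercenter of $G$), which equals the union of all the $L_n(G)$. *)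

theory Defs
  imports "HOL-Algebra.Algebra"
begin

definition p_element :: "nat \<Rightarrow> ('a, 'b) monoid_scheme \<Rightarrow> 'a \<Rightarrow> bool" where
  "p_element p G x \<longleftrightarrow> x \<in> carrier G \<and> (\<exists>k. group.ord G x = p ^ k)"

definition p'_element :: "nat \<Rightarrow> ('a, 'b) monoid_scheme \<Rightarrow> 'a \<Rightarrow> bool" where
  "p'_element p G x \<longleftrightarrow> x \<in> carrier G \<and> coprime (group.ord G x) p"

text \<open>
  The automorphism group is \<^const>\<open>AutoGroup\<close>, whose elements are the automorphisms
  extended by \<^const>\<open>undefined\<close> outside the carrier, so that each automorphism is represented
  exactly once. Its product is composition of functions written on the left (the opposite of
  the product for the right action written as exponents); orders of elements are the same in
  both groups.
\<close>

definition aut_commutator :: "('a, 'b) monoid_scheme \<Rightarrow> 'a \<Rightarrow> ('a \<Rightarrow> 'a) \<Rightarrow> 'a" where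
  "aut_commutator G x \<alpha> = inv\<^bsub>G\<^esub> x \<otimes>\<^bsub>G\<^esub> \<alpha> x"

definition iterated_aut_commutator ::
    "('a, 'b) monoid_scheme \<Rightarrow> 'a \<Rightarrow> ('a \<Rightarrow> 'a) list \<Rightarrow> 'a" where
  "iterated_aut_commutator G x \<alpha>s = foldl (aut_commutator G) x \<alpha>s"

definition absolute_center :: "nat \<Rightarrow> ('a, 'b) monoid_scheme \<Rightarrow> 'a set" where
  "absolute_center n G = {x \<in> carrier G. \<forall>\<alpha>s. length \<alpha>s = n \<and> set \<alpha>s \<subseteq> carrier (AutoGroup G) \<longrightarrow>
      iterated_aut_commutator G x \<alpha>s = \<one>\<^bsub>G\<^esub>}"

text \<open>
  The choice of the least index at which the series is stationary is immaterial, and for finite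
  groups such an index exists; see \<open>absolute_hypercenter_eqI\<close> and \<open>absolute_hypercenter_eq_Union\<close>.
\<close>

definition absolute_hypercenter :: "('a, 'b) monoid_scheme \<Rightarrow> 'a set" where
  "absolute_hypercenter G = absolute_center (LEAST n. absolute_center n G = absolute_center (Suc n) G) G"

context group
begin

lemma aut_commutator_closed:
  "x \<in> carrier G \<Longrightarrow> \<alpha> \<in> carrier (AutoGroup G) \<Longrightarrow> aut_commutator G x \<alpha> \<in> carrier G"
  by (auto simp: aut_commutator_def AutoGroup_def auto_def hom_def)

lemma absolute_center_0: "absolute_center 0 G = {\<one>}"
  by (auto simp: absolute_center_def iterated_aut_commutator_def)

lemma absolute_center_Suc:
  "absolute_center (Suc n) G =
     {x \<in> carrier G. \<forall>\<alpha>\<in>carrier (AutoGroup G). aut_commutator G x \<alpha> \<in> absolute_center n G}"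
  by (force simp: absolute_center_def iterated_aut_commutator_def length_Suc_conv aut_commutator_closed)

lemma aut_commutator_one: "\<alpha> \<in> carrier (AutoGroup G) \<Longrightarrow> aut_commutator G \<one> \<alpha> = \<one>"
  using hom_one[OF _ is_group is_group, of \<alpha>]
  by (auto simp: aut_commutator_def AutoGroup_def auto_def)

lemma absolute_center_subset_Suc: "absolute_center n G \<subseteq> absolute_center (Suc n) G"
proof (induction n)
  case 0
  then show ?case by (auto simp: absolute_center_0 absolute_center_Suc aut_commutator_one)
next
  case (Suc n)
  then show ?case by (subst (1 2) absolute_center_Suc) blast
qed

lemma absolute_center_mono: "m \<le> n \<Longrightarrow> absolute_center m G \<subseteq> absolute_center n G"
  by (rule lift_Suc_mono_le[of "\<lambda>n. absolute_center n G"]) (rule absolute_center_subset_Suc)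

lemma absolute_center_stable:
  assumes "absolute_center n G = absolute_center (Suc n) G" "n \<le> m"
  shows "absolute_center m G = absolute_center n G"
  using assms(2)
proof (induction m rule: dec_induct)
  case (step m)
  then have "absolute_center (Suc m) G = absolute_center (Suc n) G" by (simp add: absolute_center_Suc)
  with assms(1) show ?case by simp
qed simp

lemma absolute_hypercenter_eqI:
  assumes "absolute_center n G = absolute_center (Suc n) G"
  shows "absolute_hypercenter G = absolute_center n G"
proof -
  let ?P = "\<lambda>n. absolute_center n G = absolute_center (Suc n) G"
  from assms have "?P (LEAST n. ?P n)" by (rule LeastI)
  moreover from assms have "(LEAST n. ?P n) \<le> n" by (rule Least_le)
  ultimately have "absolute_center n G = absolute_center (LEAST n. ?P n) G" by (rule absolute_center_stable)
  then show ?thesis by (simp add: absolute_hypercenter_def)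
qed

lemma absolute_center_stationary:
  assumes "finite (carrier G)"
  shows "\<exists>n. absolute_center n G = absolute_center (Suc n) G"
proof (rule ccontr)
  assume "\<nexists>n. absolute_center n G = absolute_center (Suc n) G"
  then have "absolute_center n G \<subset> absolute_center (Suc n) G" for n
    using absolute_center_subset_Suc by blast
  then have less: "card (absolute_center n G) < card (absolute_center (Suc n) G)" for n
    by (rule psubset_card_mono[rotated])
      (rule finite_subset[OF _ assms], simp add: absolute_center_def)
  have "n \<le> card (absolute_center n G)" for n
  proof (induction n)
    case (Suc n)
    then show ?case using less[of n] by linarith
  qed simp
  moreover have "card (absolute_center n G) \<le> card (carrier G)" for n
    by (rule card_mono[OF assms]) (auto simp: absolute_center_def)
  ultimately have "Suc (card (carrier G)) \<le> card (carrier G)"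
    using order_trans by blast
  then show False by simp
qed

lemma absolute_hypercenter_eq_Union:
  assumes "finite (carrier G)"
  shows "absolute_hypercenter G = (\<Union>n. absolute_center n G)"
proof -
  obtain n where n: "absolute_center n G = absolute_center (Suc n) G"
    using absolute_center_stationary[OF assms] by blast
  have "absolute_center m G \<subseteq> absolute_center n G" for m
    using absolute_center_mono[of m n] absolute_center_stable[OF n, of m] by (cases "m \<le> n") auto
  then show ?thesis using absolute_hypercenter_eqI[OF n] by blast
qed

end

end

theory Submission
  imports Defs
begin

text \<open>
  Write $L_n$ for the absolute centers. All of them are characteristic subgroups, hence normal.

  If $g \<in> L_\<infinity>$, then $g$ is fixed by every automorphism of order coprime to its own. This is
  proved for all $L_n$ by induction on $n$, together with the statement that for every natural number
  $r$ the elements of $L_n$ killed by a power of $r$ form a subgroup.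
  The point of the step is that for an element $g \<in> L_{n+1}$ killed by a power of $r$, the
  commutator $c = [g,\<alpha>] \<in> L_n$ is again killed by a power of $r$
  (\<open>commutator_power_torsion\<close>). Indeed, split $c = uv$ into its $r$-part and the
  part of order coprime to $r$. By the induction hypothesis, applied to the inner automorphism of $g$,
  the element $g$ commutes with $v$; comparing powers of $g^\<alpha> = guv$ modulo the normal subgroup
  $N$ of elements of $L_n$ killed by powers of $r$ gives $v \<in> N$, so $v = 1$. If now $\<alpha>$ has
  order $s$ coprime to $r$, then $\<alpha>$ fixes $c$, so $g = g^{\<alpha>^s} = g c^s$ and $c = 1$. Products
  are handled in the same quotient: two such elements commute modulo $N$.

  Conversely, let $H$ be the characteristic subgroup of all elements fixed by every $p'$-automorphism
  and $N = H \<inter> L_\<infinity>$. The automorphism group acts on the cosets of $N$ in $H$ with all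
  $p'$-elements acting trivially. Stabilizers therefore contain Sylow $q$-subgroups for every prime
  $q \<noteq> p$, and every nontrivial orbit has size divisible by $p$
  (\<open>dvd_card_non_fixed_points\<close>). A fixed coset $Nh$ means that all $[h,\<alpha>]$ lie
  in $L_\<infinity>$, hence $h \<in> L_\<infinity>$; so $N$ is the only fixed coset, and $|H : N|$ is
  congruent to $1$ modulo $p$. A $p$-element of $H$ has order coprime to this index and must lie in
  $N$.
\<close>

section \<open>Automorphisms and characteristic subgroups\<close>

lemma AutoGroup_apply:
  assumes "\<alpha> \<in> carrier (AutoGroup G)" "\<beta> \<in> carrier (AutoGroup G)" "x \<in> carrier G"
  shows "(\<alpha> \<otimes>\<^bsub>AutoGroup G\<^esub> \<beta>) x = \<alpha> (\<beta> x)"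
  using assms by (simp add: AutoGroup_def auto_def BijGroup_def compose_eq)

lemma AutoGroup_one_apply: "x \<in> carrier G \<Longrightarrow> \<one>\<^bsub>AutoGroup G\<^esub> x = x"
  by (simp add: AutoGroup_def BijGroup_def)

lemma aut_closed: "\<alpha> \<in> carrier (AutoGroup G) \<Longrightarrow> x \<in> carrier G \<Longrightarrow> \<alpha> x \<in> carrier G"
  by (auto simp: AutoGroup_def auto_def hom_def)

lemma aut_mult:
  "\<alpha> \<in> carrier (AutoGroup G) \<Longrightarrow> x \<in> carrier G \<Longrightarrow> y \<in> carrier G \<Longrightarrow>
    \<alpha> (x \<otimes>\<^bsub>G\<^esub> y) = \<alpha> x \<otimes>\<^bsub>G\<^esub> \<alpha> y"
  by (auto simp: AutoGroup_def auto_def hom_def)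

definition characteristic :: "'a set \<Rightarrow> ('a, 'b) monoid_scheme \<Rightarrow> bool" where
  "characteristic H G \<longleftrightarrow>
     subgroup H G \<and> (\<forall>\<alpha>\<in>carrier (AutoGroup G). \<forall>x\<in>H. \<alpha> x \<in> H)"

definition inner_aut :: "('a, 'b) monoid_scheme \<Rightarrow> 'a \<Rightarrow> 'a \<Rightarrow> 'a" where
  "inner_aut G y = (\<lambda>x\<in>carrier G. y \<otimes>\<^bsub>G\<^esub> x \<otimes>\<^bsub>G\<^esub> inv\<^bsub>G\<^esub> y)"

context group
begin

lemma mult_inv_cancel:
  assumes "x \<in> carrier G" "y \<in> carrier G"
  shows "x \<otimes> (inv x \<otimes> y) = y" "inv x \<otimes> (x \<otimes> y) = y"
  using assms by (simp_all add: m_assoc[symmetric])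

lemma aut_group_hom: "\<alpha> \<in> carrier (AutoGroup G) \<Longrightarrow> group_hom G G \<alpha>"
  by (simp add: AutoGroup_def auto_def group_hom_def group_hom_axioms_def is_group)

lemma aut_inv_apply:
  assumes "\<alpha> \<in> carrier (AutoGroup G)" "x \<in> carrier G"
  shows "(inv\<^bsub>AutoGroup G\<^esub> \<alpha>) (\<alpha> x) = x" "\<alpha> ((inv\<^bsub>AutoGroup G\<^esub> \<alpha>) x) = x"
proof -
  interpret A: group "AutoGroup G" by (rule AutoGroup)
  show "(inv\<^bsub>AutoGroup G\<^esub> \<alpha>) (\<alpha> x) = x" "\<alpha> ((inv\<^bsub>AutoGroup G\<^esub> \<alpha>) x) = x"
    using assms AutoGroup_apply[of "inv\<^bsub>AutoGroup G\<^esub> \<alpha>" G \<alpha> x] AutoGroup_apply[of \<alpha> G "inv\<^bsub>AutoGroup G\<^esub> \<alpha>" x]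
    by (simp_all add: AutoGroup_one_apply)
qed

lemma finite_AutoGroup:
  assumes "finite (carrier G)"
  shows "finite (carrier (AutoGroup G))"
proof (rule finite_subset)
  show "carrier (AutoGroup G) \<subseteq> carrier G \<rightarrow>\<^sub>E carrier G"
    by (auto simp: AutoGroup_def auto_def Bij_def hom_def PiE_def)
  show "finite (carrier G \<rightarrow>\<^sub>E carrier G)" using assms by (simp add: finite_PiE)
qed

lemma inner_aut_hom: "inner_aut G \<in> hom G (AutoGroup G)"
proof -
  have "inner_aut G y \<in> carrier (AutoGroup G)" if "y \<in> carrier G" for y
    using that conjugation_is_hom
    by (auto simp: AutoGroup_def auto_def hom_def inner_aut_def BijGroup_def Pi_def m_assoc mult_inv_cancel)
  then show ?thesis
    using conjugation_is_hom
    by (auto simp: AutoGroup_def auto_def hom_def inner_aut_def[abs_def] BijGroup_def Pi_def)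
qed

lemma inner_aut_closed: "y \<in> carrier G \<Longrightarrow> inner_aut G y \<in> carrier (AutoGroup G)"
  using inner_aut_hom by (auto simp: hom_def)

lemma inner_aut_pow_eq_one:
  assumes "y \<in> carrier G" "y [^] (n::nat) = \<one>"
  shows "inner_aut G y [^]\<^bsub>AutoGroup G\<^esub> n = \<one>\<^bsub>AutoGroup G\<^esub>"
  by (metis assms hom_nat_pow[OF inner_aut_hom assms(1) is_group AutoGroup]
      hom_one[OF inner_aut_hom is_group AutoGroup])

lemma characteristic_imp_normal:
  assumes "characteristic H G"
  shows "H \<lhd> G"
proof (rule normal_invI)
  show "subgroup H G" using assms by (simp add: characteristic_def)
  fix x h assume x: "x \<in> carrier G" and h: "h \<in> H"
  then have "h \<in> carrier G" using assms subgroup.subset unfolding characteristic_def by blast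
  moreover have "inner_aut G x h \<in> H"
    using assms inner_aut_closed[OF x] h by (auto simp: characteristic_def)
  ultimately show "x \<otimes> h \<otimes> inv x \<in> H" by (simp add: inner_aut_def)
qed

text \<open>
  The series of absolute centers is built by iterating this preimage, so this is the induction step
  for all of its terms. Closure under products comes from
  $[xy,\<alpha>] = [x,\<alpha>]^y\,[y,\<alpha>]$, where conjugation by $y$ preserves $L$ because inner
  automorphisms are automorphisms; invariance comes from
  $[x^\<beta>,\<alpha>] = [x,\<gamma>]^\<beta>$, where $\<gamma>$ is the conjugate of $\<alpha>$ by $\<beta>$.
\<close>

lemma characteristic_commutator_preimage:
  assumes "characteristic L G"
  shows "characteristic {x \<in> carrier G. \<forall>\<alpha>\<in>carrier (AutoGroup G). aut_commutator G x \<alpha> \<in> L} G"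
    (is "characteristic ?K G")
proof -
  interpret A: group "AutoGroup G" by (rule AutoGroup)
  interpret L: normal L G by (rule characteristic_imp_normal[OF assms])
  have "subgroup ?K G"
  proof (rule subgroupI)
    show "?K \<subseteq> carrier G" by auto
    show "?K \<noteq> {}" using aut_commutator_one L.one_closed by auto
  next
    fix x assume x: "x \<in> ?K"
    have "aut_commutator G (inv x) \<alpha> \<in> L" if \<alpha>: "\<alpha> \<in> carrier (AutoGroup G)" for \<alpha>
    proof -
      interpret \<alpha>: group_hom G G \<alpha> by (rule aut_group_hom[OF \<alpha>])
      have "aut_commutator G (inv x) \<alpha> = x \<otimes> inv (aut_commutator G x \<alpha>) \<otimes> inv x"
        using x by (simp add: aut_commutator_def inv_mult_group m_assoc)
      moreover have "inv (aut_commutator G x \<alpha>) \<in> L" using x \<alpha> by auto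
      ultimately show ?thesis using x L.inv_op_closed2 by auto
    qed
    then show "inv x \<in> ?K" using x by auto
  next
    fix x y assume x: "x \<in> ?K" and y: "y \<in> ?K"
    have "aut_commutator G (x \<otimes> y) \<alpha> \<in> L" if \<alpha>: "\<alpha> \<in> carrier (AutoGroup G)" for \<alpha>
    proof -
      have "aut_commutator G (x \<otimes> y) \<alpha> = (inv y \<otimes> aut_commutator G x \<alpha> \<otimes> y) \<otimes> aut_commutator G y \<alpha>"
        using x y \<alpha> by (simp add: aut_commutator_def inv_mult_group m_assoc aut_mult aut_closed mult_inv_cancel)
      then show ?thesis using x y \<alpha> L.inv_op_closed1[of y "aut_commutator G x \<alpha>"] by auto
    qed
    then show "x \<otimes> y \<in> ?K" using x y by auto
  qed
  moreover have "\<beta> x \<in> ?K" if \<beta>: "\<beta> \<in> carrier (AutoGroup G)" and x: "x \<in> ?K" for \<beta> x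
  proof -
    have "aut_commutator G (\<beta> x) \<alpha> \<in> L" if \<alpha>: "\<alpha> \<in> carrier (AutoGroup G)" for \<alpha>
    proof -
      interpret \<beta>: group_hom G G \<beta> by (rule aut_group_hom[OF \<beta>])
      define \<gamma> where "\<gamma> = inv\<^bsub>AutoGroup G\<^esub> \<beta> \<otimes>\<^bsub>AutoGroup G\<^esub> (\<alpha> \<otimes>\<^bsub>AutoGroup G\<^esub> \<beta>)"
      have \<gamma>: "\<gamma> \<in> carrier (AutoGroup G)" using \<alpha> \<beta> by (simp add: \<gamma>_def)
      have "\<gamma> x = (inv\<^bsub>AutoGroup G\<^esub> \<beta>) (\<alpha> (\<beta> x))"
        using \<alpha> \<beta> x by (simp add: \<gamma>_def AutoGroup_apply)
      then have "\<beta> (\<gamma> x) = \<alpha> (\<beta> x)"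
        using \<alpha> \<beta> x by (simp add: aut_inv_apply aut_closed)
      then have "aut_commutator G (\<beta> x) \<alpha> = \<beta> (aut_commutator G x \<gamma>)"
        using x \<gamma> by (simp add: aut_commutator_def aut_closed)
      then show ?thesis using assms x \<beta> \<gamma> by (auto simp: characteristic_def)
    qed
    then show ?thesis using x \<beta> by (auto simp: aut_closed)
  qed
  ultimately show ?thesis unfolding characteristic_def by blast
qed

lemma characteristic_absolute_center: "characteristic (absolute_center n G) G"
proof (induction n)
  case 0
  have "\<alpha> \<one> = \<one>" if "\<alpha> \<in> carrier (AutoGroup G)" for \<alpha>
    using group_hom.hom_one[OF aut_group_hom[OF that]] .
  then show ?case by (simp add: characteristic_def absolute_center_0 triv_subgroup)
next
  case (Suc n)
  then show ?case by (simp add: absolute_center_Suc characteristic_commutator_preimage)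
qed

text \<open>
  The series has become stationary at the absolute hypercenter, so one more step adds nothing.
\<close>

lemma absolute_hypercenter_fixpoint:
  assumes "finite (carrier G)" "x \<in> carrier G"
    "\<And>\<alpha>. \<alpha> \<in> carrier (AutoGroup G) \<Longrightarrow> aut_commutator G x \<alpha> \<in> absolute_hypercenter G"
  shows "x \<in> absolute_hypercenter G"
proof -
  obtain n where n: "absolute_center n G = absolute_center (Suc n) G"
    using absolute_center_stationary[OF assms(1)] by blast
  have L: "absolute_hypercenter G = absolute_center n G" by (rule absolute_hypercenter_eqI[OF n])
  have "x \<in> absolute_center (Suc n) G"
    unfolding absolute_center_Suc using assms(2,3) unfolding L by blast
  then show ?thesis using n L by blast
qed

end

section \<open>Coprime automorphisms fix elements of the absolute hypercenter\<close>

text \<open>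
  For $r$ prime this is the factorization into a power of $r$ and a number prime to $r$. In general,
  repeatedly split off the greatest common divisor with $r$ until it is $1$.
\<close>

lemma coprime_part_decomposition:
  fixes n r :: nat
  assumes "n > 0"
  shows "\<exists>a b k. n = a * b \<and> a dvd r ^ k \<and> coprime b r"
  using assms
proof (induction n rule: less_induct)
  case (less n)
  show ?case
  proof (cases "coprime n r")
    case True
    then have "n = 1 * n \<and> 1 dvd r ^ 0 \<and> coprime n r" by simp
    then show ?thesis by metis
  next
    case False
    define d where "d = gcd n r"
    have d: "d dvd n" "d dvd r" "d > 0"
      using less.prems by (simp_all add: d_def)
    have "d \<noteq> 1" using False by (metis coprime_iff_gcd_eq_1 d_def)
    obtain m where m: "n = d * m" using d(1) by blast
    have "m < n" "m > 0" using m d(3) \<open>d \<noteq> 1\<close> less.prems by simp_all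
    then obtain a b k where abk: "m = a * b" "a dvd r ^ k" "coprime b r" using less.IH[of m] by blast
    have "d * a dvd r ^ Suc k" using mult_dvd_mono[OF d(2) abk(2)] by simp
    moreover have "n = (d * a) * b" using abk m by simp
    ultimately show ?thesis using abk(3) by blast
  qed
qed

definition power_torsion :: "nat \<Rightarrow> ('a, 'b) monoid_scheme \<Rightarrow> 'a set \<Rightarrow> 'a set" where
  "power_torsion r G L = {x \<in> L. \<exists>k. x [^]\<^bsub>G\<^esub> (r ^ k) = \<one>\<^bsub>G\<^esub>}"

text \<open>
  The orders are replaced by arbitrary exponents: this form adapts directly to powers of $r$, and it
  transfers from an element to the inner automorphism that it induces.
\<close>

definition coprime_automorphisms_fix :: "('a, 'b) monoid_scheme \<Rightarrow> 'a set \<Rightarrow> bool" where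
  "coprime_automorphisms_fix G L \<longleftrightarrow>
     (\<forall>x\<in>L. \<forall>\<alpha>\<in>carrier (AutoGroup G). \<forall>r s :: nat.
        coprime r s \<longrightarrow> x [^]\<^bsub>G\<^esub> r = \<one>\<^bsub>G\<^esub> \<longrightarrow>
        \<alpha> [^]\<^bsub>AutoGroup G\<^esub> s = \<one>\<^bsub>AutoGroup G\<^esub> \<longrightarrow> \<alpha> x = x)"

text \<open>In the quotient the two factors commute, so the power may be taken factor by factor.\<close>

lemma (in normal) pow_mult_mem:
  fixes n :: nat
  assumes "a \<in> carrier G" "b \<in> carrier G" "(a \<otimes> b) \<otimes> inv (b \<otimes> a) \<in> H"
    and "a [^] n \<in> H" "b [^] n \<in> H"
  shows "(a \<otimes> b) [^] n \<in> H"
proof -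
  interpret Q: group "G Mod H" by (rule factorgroup_is_group)
  have mult: "H #> (x \<otimes> y) = (H #> x) \<otimes>\<^bsub>G Mod H\<^esub> (H #> y)" if "x \<in> carrier G" "y \<in> carrier G" for x y
    using that rcos_sum by (simp add: FactGroup_def)
  have carr: "H #> x \<in> carrier (G Mod H)" if "x \<in> carrier G" for x
    using that by (auto simp: FactGroup_def RCOSETS_def)
  have coset: "H #> (a \<otimes> b) = H #> (b \<otimes> a)"
    by (rule coset_mult_inv1[OF rcos_const[OF is_group assms(3)]
          m_closed[OF assms(1,2)] m_closed[OF assms(2,1)] subset])
  have "H #> (a \<otimes> b) [^] n = ((H #> a) \<otimes>\<^bsub>G Mod H\<^esub> (H #> b)) [^]\<^bsub>G Mod H\<^esub> n"
    by (simp only: mult[OF assms(1,2), symmetric] FactGroup_pow[OF m_closed[OF assms(1,2)]])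
  also have "\<dots> = (H #> a) [^]\<^bsub>G Mod H\<^esub> n \<otimes>\<^bsub>G Mod H\<^esub> (H #> b) [^]\<^bsub>G Mod H\<^esub> n"
    by (rule Q.pow_mult_distrib[OF _ carr[OF assms(1)] carr[OF assms(2)]])
      (simp only: mult[OF assms(1,2), symmetric] mult[OF assms(2,1), symmetric] coset)
  also have "\<dots> = H #> (a [^] n \<otimes> b [^] n)"
    by (simp only: FactGroup_pow[OF assms(1)] FactGroup_pow[OF assms(2)]
        mult[OF nat_pow_closed[OF assms(1)] nat_pow_closed[OF assms(2)]])
  also have "\<dots> = H"
    by (rule rcos_const[OF is_group subgroup.m_closed[OF subgroup_axioms assms(4,5)]])
  finally show ?thesis by (rule coset_join1[OF _ nat_pow_closed[OF m_closed[OF assms(1,2)]] subgroup_axioms])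
qed

context group
begin

text \<open>
  Both parts are powers of $x$, by Bezout's identity for the coprime factors of the order of $x$. This
  is why they commute and lie in every subgroup containing $x$.
\<close>

lemma power_torsion_split:
  assumes "finite (carrier G)" "x \<in> carrier G"
  obtains u v b k where "u \<in> carrier G" "v \<in> carrier G" "x = u \<otimes> v" "u \<otimes> v = v \<otimes> u"
    "u [^] ((r::nat) ^ k) = \<one>" "v [^] (b::nat) = \<one>" "coprime b r"
    "\<And>S. subgroup S G \<Longrightarrow> x \<in> S \<Longrightarrow> u \<in> S \<and> v \<in> S"
proof -
  have "ord x > 0" using assms ord_ge_1 by fastforce
  then obtain a b k where abk: "ord x = a * b" "a dvd r ^ k" "coprime b r"
    using coprime_part_decomposition by blast
  then have a: "a \<noteq> 0" using \<open>ord x > 0\<close> by auto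
  have "coprime a b" using abk by (meson coprime_commute coprime_divisors coprime_power_right_iff dvd_refl)
  with bezout_nat[OF a, of b] obtain i j where ij: "a * i = b * j + 1" by auto
  define u v where "u = inv (x [^] (b * j))" and "v = x [^] (a * i)"
  have uv: "u \<in> carrier G" "v \<in> carrier G" using assms by (auto simp: u_def v_def)
  have v: "v = x [^] (b * j) \<otimes> x" by (simp add: v_def ij)
  have comm: "x [^] (b * j) \<otimes> x = x \<otimes> x [^] (b * j)"
    using assms nat_pow_Suc2[of x "b * j"] by simp
  have x1: "x = u \<otimes> v" using assms by (simp add: u_def v m_assoc[symmetric])
  have x2: "x = v \<otimes> u" using assms by (simp add: u_def v comm m_assoc)
  have "u [^] (r ^ k) = inv (x [^] (b * j * r ^ k))"
    using assms by (simp add: u_def nat_pow_inv nat_pow_pow)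
  also have "x [^] (b * j * r ^ k) = \<one>"
    using assms abk by (subst pow_eq_id) (auto simp: mult_ac intro: mult_dvd_mono)
  finally have "u [^] (r ^ k) = \<one>" by simp
  moreover have "v [^] b = \<one>"
    using assms abk by (simp add: v_def nat_pow_pow pow_eq_id)
  moreover have "u \<in> S \<and> v \<in> S" if "subgroup S G" "x \<in> S" for S
  proof -
    interpret S: subgroup S G by fact
    have "x [^] (n::nat) \<in> S" for n using \<open>x \<in> S\<close> by (induction n) auto
    then show ?thesis by (auto simp: u_def v_def)
  qed
  moreover have "u \<otimes> v = v \<otimes> u" using x1 x2 by simp
  ultimately show thesis using uv x1 abk(3) by (intro that)
qed

lemma aut_pow_apply:
  assumes \<alpha>: "\<alpha> \<in> carrier (AutoGroup G)" and x: "x \<in> carrier G" and c: "c \<in> carrier G"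
    and "\<alpha> x = x \<otimes> c" "\<alpha> c = c"
  shows "(\<alpha> [^]\<^bsub>AutoGroup G\<^esub> (n::nat)) x = x \<otimes> c [^] n"
proof -
  interpret A: group "AutoGroup G" by (rule AutoGroup)
  interpret \<alpha>: group_hom G G \<alpha> by (rule aut_group_hom[OF \<alpha>])
  show ?thesis
  proof (induction n)
    case 0
    then show ?case using x by (simp add: AutoGroup_one_apply)
  next
    case (Suc n)
    have "(\<alpha> [^]\<^bsub>AutoGroup G\<^esub> Suc n) x = \<alpha> ((\<alpha> [^]\<^bsub>AutoGroup G\<^esub> n) x)"
      using \<alpha> x A.nat_pow_Suc2[OF \<alpha>, of n] by (simp add: AutoGroup_apply del: A.nat_pow_Suc)
    also have "\<dots> = x \<otimes> (c \<otimes> c [^] n)"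
      using assms Suc by (simp add: m_assoc \<alpha>.hom_nat_pow)
    also have "c \<otimes> c [^] n = c [^] Suc n" using c by (rule nat_pow_Suc2[symmetric])
    finally show ?case .
  qed
qed

lemma pow_eq_one_coprime:
  fixes m n :: nat
  assumes "x \<in> carrier G" "x [^] m = \<one>" "x [^] n = \<one>" "coprime m n"
  shows "x = \<one>"
  using assms by (metis coprime_common_divisor_nat pow_eq_id ord_eq_1)

lemma characteristic_power_torsion:
  assumes L: "characteristic L G" and sub: "subgroup (power_torsion r G L) G"
  shows "characteristic (power_torsion r G L) G"
  unfolding characteristic_def
proof (intro conjI ballI sub)
  fix \<alpha> x assume \<alpha>: "\<alpha> \<in> carrier (AutoGroup G)" and x: "x \<in> power_torsion r G L"
  interpret \<alpha>: group_hom G G \<alpha> by (rule aut_group_hom[OF \<alpha>])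
  from x sub have "x \<in> carrier G" using subgroup.subset by blast
  then have "\<alpha> x [^] n = \<alpha> (x [^] n)" for n :: nat by (rule \<alpha>.hom_nat_pow[symmetric])
  with x \<alpha> L show "\<alpha> x \<in> power_torsion r G L"
    by (auto simp: power_torsion_def characteristic_def) (metis \<alpha>.hom_one)
qed

text \<open>
  The heart of the forward direction: it gives the control over the commutator that a decomposition of
  the nilpotent group $L_{n+1}$ into its Sylow subgroups would give, but uses only information about
  $L_n$.
\<close>

lemma commutator_power_torsion:
  assumes fin: "finite (carrier G)" and L: "characteristic L G"
    and cfix: "coprime_automorphisms_fix G L" and sub: "subgroup (power_torsion r G L) G"
    and x: "x \<in> carrier G" "x [^] ((r::nat) ^ k) = \<one>" and \<alpha>: "\<alpha> \<in> carrier (AutoGroup G)"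
    and comm: "aut_commutator G x \<alpha> \<in> L"
  shows "aut_commutator G x \<alpha> \<in> power_torsion r G L"
proof -
  interpret A: group "AutoGroup G" by (rule AutoGroup)
  interpret \<alpha>: group_hom G G \<alpha> by (rule aut_group_hom[OF \<alpha>])
  interpret N: normal "power_torsion r G L" G
    by (rule characteristic_imp_normal[OF characteristic_power_torsion[OF L sub]])
  define c where "c = aut_commutator G x \<alpha>"
  have c: "c \<in> carrier G" using x \<alpha> by (simp add: c_def aut_commutator_closed)
  have \<alpha>x: "\<alpha> x = x \<otimes> c" using x \<alpha> by (simp add: c_def aut_commutator_def m_assoc[symmetric])
  obtain u v b l where uv: "u \<in> carrier G" "v \<in> carrier G" "c = u \<otimes> v" "u \<otimes> v = v \<otimes> u"
    and u: "u [^] (r ^ l) = \<one>" and v: "v [^] b = \<one>" "coprime b r"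
    and S: "\<And>S. subgroup S G \<Longrightarrow> c \<in> S \<Longrightarrow> u \<in> S \<and> v \<in> S"
    using power_torsion_split[OF fin c, of r] by metis
  have uvL: "u \<in> L" "v \<in> L" using S[of L] L comm by (auto simp: characteristic_def c_def)
  then have uN: "u \<in> power_torsion r G L" using u by (auto simp: power_torsion_def)
  \<comment> \<open>Conjugation by \<open>x\<close> has order dividing a power of \<open>r\<close>, so it fixes the part of order coprime to \<open>r\<close>.\<close>
  have "inner_aut G x v = v"
    using cfix uvL v inner_aut_closed[OF x(1)] inner_aut_pow_eq_one[OF x]
    unfolding coprime_automorphisms_fix_def by (metis coprime_power_right_iff)
  then have "x \<otimes> v \<otimes> inv x = v" using uv by (simp add: inner_aut_def)
  then have xv: "x \<otimes> v = v \<otimes> x" using uv x by (metis inv_solve_right m_closed)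
  have xuv: "(x \<otimes> u) \<otimes> v = v \<otimes> (x \<otimes> u)" using uv x xv by (metis m_assoc)
  have "\<one> = \<alpha> (x [^] (r ^ k))" using x by simp
  also have "\<dots> = (x \<otimes> u \<otimes> v) [^] (r ^ k)"
    by (simp only: \<alpha>.hom_nat_pow[OF x(1)] \<alpha>x uv(3) m_assoc[OF x(1) uv(1,2)])
  also have "\<dots> = (x \<otimes> u) [^] (r ^ k) \<otimes> v [^] (r ^ k)"
    using x uv xuv by (intro pow_mult_distrib) auto
  finally have one: "(x \<otimes> u) [^] (r ^ k) \<otimes> v [^] (r ^ k) = \<one>" by simp
  \<comment> \<open>Modulo the torsion subgroup, \<open>x \<otimes> u\<close> is \<open>x\<close>, so it satisfies the same power relation.\<close>
  have "(x \<otimes> u) [^] (r ^ k) \<in> power_torsion r G L"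
  proof (rule N.pow_mult_mem)
    have "(x \<otimes> u \<otimes> inv x) \<otimes> inv u \<in> power_torsion r G L"
      using N.inv_op_closed2[OF x(1) uN] uN by blast
    then show "(x \<otimes> u) \<otimes> inv (u \<otimes> x) \<in> power_torsion r G L"
      using x(1) uv(1) by (simp add: inv_mult_group m_assoc)
    have "u [^] (n::nat) \<in> power_torsion r G L" for n using uN by (induction n) auto
    then show "u [^] (r ^ k) \<in> power_torsion r G L" .
  qed (use x uv in auto)
  then have "inv ((x \<otimes> u) [^] (r ^ k)) \<in> power_torsion r G L" by simp
  also have "inv ((x \<otimes> u) [^] (r ^ k)) = v [^] (r ^ k)"
    using one x uv by (intro inv_equality[symmetric, THEN sym]) (auto intro: inv_comm)
  finally obtain m where "(v [^] (r ^ k)) [^] (r ^ m) = \<one>" by (auto simp: power_torsion_def)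
  then have "v [^] (r ^ (k + m)) = \<one>" using uv by (simp add: nat_pow_pow power_add)
  then have "v = \<one>" using v uv by (metis pow_eq_one_coprime coprime_power_right_iff)
  then have "c = u" using uv by simp
  then show ?thesis using uN c_def by simp
qed

lemma coprime_automorphisms_fix_step:
  assumes fin: "finite (carrier G)" and L: "characteristic L G"
    and cfix: "coprime_automorphisms_fix G L" and sub: "\<And>r. subgroup (power_torsion r G L) G"
  defines "K \<equiv> {x \<in> carrier G. \<forall>\<alpha>\<in>carrier (AutoGroup G). aut_commutator G x \<alpha> \<in> L}"
  shows "coprime_automorphisms_fix G K"
  unfolding coprime_automorphisms_fix_def
proof (intro ballI allI impI)
  fix x \<alpha> and r s :: nat
  assume x: "x \<in> K" and \<alpha>: "\<alpha> \<in> carrier (AutoGroup G)" and rs: "coprime r s"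
    and xr: "x [^] r = \<one>" and \<alpha>s: "\<alpha> [^]\<^bsub>AutoGroup G\<^esub> s = \<one>\<^bsub>AutoGroup G\<^esub>"
  define c where "c = aut_commutator G x \<alpha>"
  have xG: "x \<in> carrier G" and cL: "c \<in> L" using x \<alpha> by (auto simp: K_def c_def)
  have c: "c \<in> carrier G" using xG \<alpha> by (simp add: c_def aut_commutator_closed)
  have \<alpha>x: "\<alpha> x = x \<otimes> c"
    using xG \<alpha> by (simp add: c_def aut_commutator_def m_assoc[symmetric] aut_closed)
  have "x [^] (r ^ 1) = \<one>" using xr by simp
  from commutator_power_torsion[OF fin L cfix sub xG this \<alpha>] cL
  obtain k where k: "c [^] (r ^ k) = \<one>" by (auto simp: power_torsion_def c_def)
  have "coprime (r ^ k) s" using rs by (metis coprime_power_left_iff)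
  then have "\<alpha> c = c"
    using cfix[unfolded coprime_automorphisms_fix_def, rule_format, OF cL \<alpha> _ k \<alpha>s] by simp
  then have "x = x \<otimes> c [^] s"
    using aut_pow_apply[OF \<alpha> xG c \<alpha>x, of s] \<alpha>s xG by (simp add: AutoGroup_one_apply)
  then have "c [^] s = \<one>" using xG c r_cancel_one'[of "c [^] s" x] by simp
  then have "c = \<one>" using pow_eq_one_coprime[OF c k] \<open>coprime (r ^ k) s\<close> by blast
  then show "\<alpha> x = x" using \<alpha>x xG by simp
qed

lemma subgroup_power_torsion_step:
  assumes fin: "finite (carrier G)" and L: "characteristic L G"
    and cfix: "coprime_automorphisms_fix G L" and sub: "subgroup (power_torsion r G L) G"
  defines "K \<equiv> {x \<in> carrier G. \<forall>\<alpha>\<in>carrier (AutoGroup G). aut_commutator G x \<alpha> \<in> L}"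
  shows "subgroup (power_torsion r G K) G"
proof -
  interpret N: normal "power_torsion r G L" G
    by (rule characteristic_imp_normal[OF characteristic_power_torsion[OF L sub]])
  have "characteristic K G" unfolding K_def by (rule characteristic_commutator_preimage[OF L])
  then interpret K: subgroup K G by (simp add: characteristic_def)
  show ?thesis
  proof (rule subgroupI)
    show "power_torsion r G K \<subseteq> carrier G" by (auto simp: power_torsion_def)
    have "\<one> \<in> power_torsion r G K" by (auto simp: power_torsion_def)
    then show "power_torsion r G K \<noteq> {}" by blast
  next
    fix x assume "x \<in> power_torsion r G K"
    then show "inv x \<in> power_torsion r G K" by (auto simp: power_torsion_def nat_pow_inv)
  next
    fix x y assume "x \<in> power_torsion r G K" "y \<in> power_torsion r G K"
    then obtain k l where x: "x \<in> K" "x [^] (r ^ k) = \<one>" and y: "y \<in> K" "y [^] (r ^ l) = \<one>"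
      by (auto simp: power_torsion_def)
    have xG: "x \<in> carrier G" and yG: "y \<in> carrier G" using x y by auto
    \<comment> \<open>The commutator of \<open>x\<close> with this automorphism is the group commutator of \<open>x\<close> and \<open>y\<close>.\<close>
    define \<beta> where "\<beta> = inner_aut G (inv y)"
    have \<beta>: "\<beta> \<in> carrier (AutoGroup G)" using yG by (simp add: \<beta>_def inner_aut_closed)
    have "aut_commutator G x \<beta> \<in> L" using x(1) \<beta> unfolding K_def by blast
    from commutator_power_torsion[OF fin L cfix sub xG x(2) \<beta> this]
    have "aut_commutator G x \<beta> \<in> power_torsion r G L" .
    moreover have "aut_commutator G x \<beta> = inv x \<otimes> (inv y \<otimes> x \<otimes> y)"
      using xG yG by (simp add: \<beta>_def inner_aut_def aut_commutator_def)
    ultimately have "inv x \<otimes> (inv y \<otimes> x \<otimes> y) \<in> power_torsion r G L" by simp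
    from N.inv_op_closed2[OF m_closed[OF yG xG] this]
    have comm: "(x \<otimes> y) \<otimes> inv (y \<otimes> x) \<in> power_torsion r G L"
      using xG yG by (simp add: inv_mult_group m_assoc mult_inv_cancel)
    have "(x \<otimes> y) [^] (r ^ (k + l)) \<in> power_torsion r G L"
    proof (rule N.pow_mult_mem[OF xG yG comm])
      have "x [^] (r ^ (k + l)) = (x [^] (r ^ k)) [^] (r ^ l)"
        by (simp only: nat_pow_pow[OF xG] power_add)
      then have "x [^] (r ^ (k + l)) = \<one>" by (simp only: x(2) nat_pow_one)
      moreover have "y [^] (r ^ (k + l)) = (y [^] (r ^ l)) [^] (r ^ k)"
        by (simp only: nat_pow_pow[OF yG] power_add mult.commute)
      then have "y [^] (r ^ (k + l)) = \<one>" by (simp only: y(2) nat_pow_one)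
      ultimately show "x [^] (r ^ (k + l)) \<in> power_torsion r G L" "y [^] (r ^ (k + l)) \<in> power_torsion r G L"
        by (simp_all only: N.one_closed)
    qed
    then obtain m where "((x \<otimes> y) [^] (r ^ (k + l))) [^] (r ^ m) = \<one>" by (auto simp: power_torsion_def)
    then have "(x \<otimes> y) [^] (r ^ (k + l + m)) = \<one>" using xG yG by (simp add: nat_pow_pow power_add)
    then show "x \<otimes> y \<in> power_torsion r G K" using x y by (auto simp: power_torsion_def)
  qed
qed

text \<open>
  The induction must carry both statements, since the step for each of them uses both for the
  preceding term.
\<close>

lemma coprime_automorphisms_fix_absolute_center:
  assumes fin: "finite (carrier G)"
  shows "coprime_automorphisms_fix G (absolute_center n G)"
proof -
  have "coprime_automorphisms_fix G (absolute_center n G) \<and>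
      (\<forall>r. subgroup (power_torsion r G (absolute_center n G)) G)"
  proof (induction n)
    case 0
    have "power_torsion r G {\<one>} = {\<one>}" for r by (auto simp: power_torsion_def)
    moreover have "\<alpha> \<one> = \<one>" if "\<alpha> \<in> carrier (AutoGroup G)" for \<alpha>
      using group_hom.hom_one[OF aut_group_hom[OF that]] .
    ultimately show ?case
      by (simp add: coprime_automorphisms_fix_def absolute_center_0 triv_subgroup)
  next
    case (Suc n)
    then show ?case
      using coprime_automorphisms_fix_step[OF fin characteristic_absolute_center[of n]]
        subgroup_power_torsion_step[OF fin characteristic_absolute_center[of n]]
      by (simp add: absolute_center_Suc)
  qed
  then show ?thesis ..
qed

end

section \<open>Actions in which elements of order prime to p are trivial\<close>

text \<open>
  The set of points moved by the action is a union of nontrivial orbits. If a prime $q \<noteq> p$ divided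
  the length of one of them, then the stabilizer would not contain a Sylow $q$-subgroup; but it
  contains all $p'$-elements, in particular every $q$-element. So $p$ is the only prime that can
  divide the length of an orbit.
\<close>

lemma (in group_action) dvd_card_non_fixed_points:
  assumes fin: "finite (carrier G)" and finE: "finite E" and p: "Factorial_Ring.prime p"
    and triv: "\<And>a x. p'_element p G a \<Longrightarrow> x \<in> E \<Longrightarrow> \<phi> a x = x"
  shows "p dvd card {x \<in> E. \<exists>a\<in>carrier G. \<phi> a x \<noteq> x}"
proof -
  interpret G: group G using group_hom group_hom.axioms(1) by auto
  define F where "F = {x \<in> E. \<exists>a\<in>carrier G. \<phi> a x \<noteq> x}"
  have orbE: "orbit G \<phi> x \<subseteq> E" if "x \<in> E" for x
    using that element_image by (auto simp: orbit_def)
  have p_dvd: "p dvd card (orbit G \<phi> x)" if x: "x \<in> F" for x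
  proof -
    have xE: "x \<in> E" using x by (simp add: F_def)
    obtain a where a: "a \<in> carrier G" "\<phi> a x \<noteq> x" using x by (auto simp: F_def)
    have "card (orbit G \<phi> x) \<noteq> 1"
    proof
      assume "card (orbit G \<phi> x) = 1"
      moreover have "x \<in> orbit G \<phi> x" "\<phi> a x \<in> orbit G \<phi> x"
        using orbit_refl[OF xE] a by (auto simp: orbit_def)
      ultimately show False using a(2) by (metis card_1_singletonE singletonD)
    qed
    then obtain q where q: "Factorial_Ring.prime q" "q dvd card (orbit G \<phi> x)"
      using prime_factor_nat by blast
    have "q = p"
    proof (rule ccontr)
      assume "q \<noteq> p"
      have ordG: "order G \<noteq> 0" using fin G.order_gt_0_iff_finite by simp
      have nunit: "\<not> is_unit q" using prime_gt_1_nat[OF q(1)] by simp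
      define k where "k = multiplicity q (order G)"
      obtain m where m: "order G = q ^ k * m" "\<not> q dvd m"
        unfolding k_def by (rule multiplicity_decompose'[OF ordG nunit])
      obtain Q where Q: "subgroup Q G" "card Q = q ^ k"
        using sylow_thm[OF q(1) G.is_group m(1) fin] by blast
      interpret S: subgroup "stabilizer G \<phi> x" G by (rule stabilizer_subgroup[OF xE])
      have "Q \<subseteq> stabilizer G \<phi> x"
      proof
        fix h assume h: "h \<in> Q"
        have hG: "h \<in> carrier G" using h Q subgroup.subset by blast
        have "h [^]\<^bsub>G\<lparr>carrier := Q\<rparr>\<^esub> order (G\<lparr>carrier := Q\<rparr>) = \<one>\<^bsub>G\<lparr>carrier := Q\<rparr>\<^esub>"
          using h by (intro group.pow_order_eq_1 G.subgroup_imp_group Q) auto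
        then have "h [^] (q ^ k) = \<one>"
          by (simp add: order_def Q(2) G.nat_pow_consistent[symmetric])
        then have "G.ord h dvd q ^ k" using hG by (simp add: G.pow_eq_id)
        moreover have "coprime (q ^ k) p"
          using q(1) p \<open>q \<noteq> p\<close> by (simp add: primes_coprime)
        ultimately have "coprime (G.ord h) p" by (rule coprime_divisors[OF _ dvd_refl])
        then have "p'_element p G h" using hG by (simp add: p'_element_def)
        then have "\<phi> h x = x" by (rule triv[OF _ xE])
        then show "h \<in> stabilizer G \<phi> x" using hG unfolding stabilizer_def by blast
      qed
      then have "subgroup Q (G\<lparr>carrier := stabilizer G \<phi> x\<rparr>)"
        by (rule G.subgroup_incl[OF Q(1) S.subgroup_axioms])
      then have "order (G\<lparr>carrier := stabilizer G \<phi> x\<rparr>)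
          = card (rcosets\<^bsub>G\<lparr>carrier := stabilizer G \<phi> x\<rparr>\<^esub> Q) * card Q"
        by (rule group.lagrange[OF G.subgroup_imp_group[OF S.subgroup_axioms], symmetric])
      then have "card (stabilizer G \<phi> x)
          = card (rcosets\<^bsub>G\<lparr>carrier := stabilizer G \<phi> x\<rparr>\<^esub> Q) * q ^ k"
        unfolding order_def Q(2) by simp
      then have "q ^ k dvd card (stabilizer G \<phi> x)" by (rule dvdI[OF trans[OF _ mult.commute]])
      then have "q * q ^ k dvd order G"
        unfolding orbit_stabilizer_theorem[OF xE, symmetric] by (rule mult_dvd_mono[OF q(2)])
      then have "q ^ k * q dvd q ^ k * m" unfolding m(1) mult.commute[of q "q ^ k"] .
      moreover have "0 < q ^ k" using prime_gt_0_nat[OF q(1)] by simp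
      ultimately have "q dvd m" using nat_mult_dvd_cancel1[of "q ^ k" q m] by blast
      with m(2) show False ..
    qed
    with q show ?thesis by simp
  qed
  have orbF: "orbit G \<phi> x \<subseteq> F" if x: "x \<in> F" for x
  proof
    fix y assume y: "y \<in> orbit G \<phi> x"
    have xE: "x \<in> E" using x by (simp add: F_def)
    with y orbE have yE: "y \<in> E" by blast
    have "x \<in> orbit G \<phi> y" by (rule orbit_sym[OF xE yE y])
    show "y \<in> F"
    proof (rule ccontr)
      assume "y \<notin> F"
      then have "\<And>a. a \<in> carrier G \<Longrightarrow> \<phi> a y = y" using yE by (auto simp: F_def)
      then have "x = y" using \<open>x \<in> orbit G \<phi> y\<close> by (auto simp: orbit_def)
      with x \<open>y \<notin> F\<close> show False by simp
    qed
  qed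
  have F: "F = \<Union> (orbit G \<phi> ` F)"
  proof
    show "F \<subseteq> \<Union> (orbit G \<phi> ` F)"
    proof
      fix x assume x: "x \<in> F"
      then have "x \<in> orbit G \<phi> x" by (intro orbit_refl) (simp add: F_def)
      with x show "x \<in> \<Union> (orbit G \<phi> ` F)" by blast
    qed
    show "\<Union> (orbit G \<phi> ` F) \<subseteq> F" using orbF by blast
  qed
  have "p dvd card (\<Union> (orbit G \<phi> ` F))"
  proof (rule dvd_partition)
    show "finite (\<Union> (orbit G \<phi> ` F))" unfolding F[symmetric] using finE by (simp add: F_def)
    show "\<forall>c\<in>orbit G \<phi> ` F. p dvd card c" using p_dvd by blast
    have "orbit G \<phi> ` F \<subseteq> orbits G E \<phi>" by (auto simp: F_def orbits_def)
    then show "\<forall>c1\<in>orbit G \<phi> ` F. \<forall>c2\<in>orbit G \<phi> ` F. c1 \<noteq> c2 \<longrightarrow> c1 \<inter> c2 = {}"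
      using disjoint_union by blast
  qed
  then have "p dvd card F" by (simp only: F[symmetric])
  then show ?thesis by (simp only: F_def)
qed

section \<open>The action of the automorphism group on cosets\<close>

text \<open>The coset of $x$ is trivial because its order divides both $n$ and the index.\<close>

lemma (in normal) mem_if_coprime_index:
  fixes n :: nat
  assumes "finite (carrier G)" "x \<in> carrier G" "x [^] n = \<one>" "coprime n (card (rcosets H))"
  shows "x \<in> H"
proof -
  interpret Q: group "G Mod H" by (rule factorgroup_is_group)
  have X: "H #> x \<in> carrier (G Mod H)" using assms(2) by (auto simp: FactGroup_def RCOSETS_def)
  have "(H #> x) [^]\<^bsub>G Mod H\<^esub> n = H #> \<one>"
    by (simp only: FactGroup_pow[OF assms(2)] assms(3))
  also have "\<dots> = \<one>\<^bsub>G Mod H\<^esub>" by (simp add: coset_mult_one subset FactGroup_def)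
  finally have "(H #> x) [^]\<^bsub>G Mod H\<^esub> n = \<one>\<^bsub>G Mod H\<^esub>" .
  moreover have "(H #> x) [^]\<^bsub>G Mod H\<^esub> card (rcosets H) = \<one>\<^bsub>G Mod H\<^esub>"
    using Q.pow_order_eq_1[OF X] by (simp add: order_def FactGroup_def)
  ultimately have "H #> x = \<one>\<^bsub>G Mod H\<^esub>"
    using Q.pow_eq_one_coprime[OF X] assms(4) by blast
  then have "H #> x = H" by (simp add: FactGroup_def)
  then show ?thesis by (rule coset_join1[OF _ assms(2) subgroup_axioms])
qed

context group
begin

lemma aut_image_coset:
  assumes N: "characteristic N G" and \<alpha>: "\<alpha> \<in> carrier (AutoGroup G)" and x: "x \<in> carrier G"
  shows "\<alpha> ` (N #> x) = N #> \<alpha> x"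
proof -
  interpret A: group "AutoGroup G" by (rule AutoGroup)
  interpret N: subgroup N G using N by (simp add: characteristic_def)
  have mem: "\<beta> n \<in> N" if "\<beta> \<in> carrier (AutoGroup G)" "n \<in> N" for \<beta> n
    using N that by (simp add: characteristic_def)
  have "N \<subseteq> \<alpha> ` N"
  proof
    fix n assume n: "n \<in> N"
    then have "n = \<alpha> ((inv\<^bsub>AutoGroup G\<^esub> \<alpha>) n)" using \<alpha> by (simp add: aut_inv_apply)
    moreover have "(inv\<^bsub>AutoGroup G\<^esub> \<alpha>) n \<in> N" using n \<alpha> by (simp add: mem)
    ultimately show "n \<in> \<alpha> ` N" by (rule image_eqI)
  qed
  then have image: "\<alpha> ` N = N" using mem[OF \<alpha>] by blast
  have "\<alpha> ` (N #> x) = (\<lambda>n. \<alpha> (n \<otimes> x)) ` N" by (auto simp: r_coset_def)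
  also have "\<dots> = (\<lambda>n. \<alpha> n \<otimes> \<alpha> x) ` N"
    using \<alpha> x by (intro image_cong) (simp_all add: aut_mult)
  also have "\<dots> = (\<lambda>n. n \<otimes> \<alpha> x) ` (\<alpha> ` N)" by (simp add: image_image)
  finally show ?thesis by (auto simp: image r_coset_def)
qed

text \<open>
  The maps are restricted to the set of cosets because the group of bijections of a set consists of
  extensional functions.
\<close>

lemma aut_action_on_cosets:
  assumes H: "characteristic H G" and N: "characteristic N G"
  defines "E \<equiv> rcosets\<^bsub>G\<lparr>carrier := H\<rparr>\<^esub> N"
  shows "group_action (AutoGroup G) E (\<lambda>\<alpha>. \<lambda>C\<in>E. \<alpha> ` C)"
proof -
  interpret A: group "AutoGroup G" by (rule AutoGroup)
  interpret H: subgroup H G using H by (simp add: characteristic_def)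
  have E: "C \<in> E \<longleftrightarrow> (\<exists>h\<in>H. C = N #> h)" for C
    unfolding E_def RCOSETS_def r_coset_def by simp
  have NG: "N \<subseteq> carrier G" using N subgroup.subset unfolding characteristic_def by blast
  have sub: "C \<subseteq> carrier G" if "C \<in> E" for C
  proof -
    from that[unfolded E] obtain h where h: "h \<in> H" "C = N #> h" by (rule bexE)
    show ?thesis unfolding h(2) by (rule r_coset_subset_G[OF NG H.mem_carrier[OF h(1)]])
  qed
  have closed: "\<alpha> ` C \<in> E" if "\<alpha> \<in> carrier (AutoGroup G)" "C \<in> E" for \<alpha> C
  proof -
    from that(2)[unfolded E] obtain h where h: "h \<in> H" "C = N #> h" by (rule bexE)
    have "\<alpha> ` C = N #> \<alpha> h" unfolding h(2) by (rule aut_image_coset[OF N that(1) H.mem_carrier[OF h(1)]])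
    moreover have "\<alpha> h \<in> H" using H h(1) that(1) unfolding characteristic_def by blast
    ultimately show ?thesis unfolding E by (rule bexI)
  qed
  have inv: "(inv\<^bsub>AutoGroup G\<^esub> \<alpha>) ` (\<alpha> ` C) = C" "\<alpha> ` ((inv\<^bsub>AutoGroup G\<^esub> \<alpha>) ` C) = C"
    if \<alpha>: "\<alpha> \<in> carrier (AutoGroup G)" and C: "C \<in> E" for \<alpha> C
  proof -
    have "(inv\<^bsub>AutoGroup G\<^esub> \<alpha>) (\<alpha> x) = x" "\<alpha> ((inv\<^bsub>AutoGroup G\<^esub> \<alpha>) x) = x" if x: "x \<in> C" for x
      using aut_inv_apply[OF \<alpha> subsetD[OF sub[OF C]]] x by simp_all
    then show "(inv\<^bsub>AutoGroup G\<^esub> \<alpha>) ` (\<alpha> ` C) = C" "\<alpha> ` ((inv\<^bsub>AutoGroup G\<^esub> \<alpha>) ` C) = C"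
      by (simp_all add: image_image)
  qed
  have Bij: "(\<lambda>C\<in>E. \<alpha> ` C) \<in> Bij E" if \<alpha>: "\<alpha> \<in> carrier (AutoGroup G)" for \<alpha>
  proof -
    have "bij_betw (\<lambda>C\<in>E. \<alpha> ` C) E E"
      by (rule bij_betw_byWitness[where f' = "\<lambda>C. (inv\<^bsub>AutoGroup G\<^esub> \<alpha>) ` C"])
        (use \<alpha> closed inv in auto)
    then show ?thesis by (simp add: Bij_def)
  qed
  have "(\<lambda>C\<in>E. (\<alpha> \<otimes>\<^bsub>AutoGroup G\<^esub> \<beta>) ` C) = compose E (\<lambda>C\<in>E. \<alpha> ` C) (\<lambda>C\<in>E. \<beta> ` C)"
    if "\<alpha> \<in> carrier (AutoGroup G)" "\<beta> \<in> carrier (AutoGroup G)" for \<alpha> \<beta>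
  proof (rule extensionalityI[where A = E])
    fix C assume C: "C \<in> E"
    have "(\<alpha> \<otimes>\<^bsub>AutoGroup G\<^esub> \<beta>) ` C = \<alpha> ` \<beta> ` C"
      unfolding image_image
      by (rule image_cong[OF refl]) (rule AutoGroup_apply[OF that subsetD[OF sub[OF C]]])
    then show "(\<lambda>C\<in>E. (\<alpha> \<otimes>\<^bsub>AutoGroup G\<^esub> \<beta>) ` C) C
        = compose E (\<lambda>C\<in>E. \<alpha> ` C) (\<lambda>C\<in>E. \<beta> ` C) C"
      using C closed[OF that(2) C] by (simp add: compose_eq)
  qed auto
  then have "(\<lambda>\<alpha>. \<lambda>C\<in>E. \<alpha> ` C) \<in> hom (AutoGroup G) (BijGroup E)"
    using Bij by (intro homI) (simp_all add: BijGroup_def)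
  then show ?thesis
    by (simp add: group_action_def group_hom_def group_hom_axioms_def group_BijGroup A.is_group)
qed

lemma p'_element_conjugate:
  assumes "p'_element p G x" "y \<in> carrier G"
  shows "p'_element p G (y \<otimes> x \<otimes> inv y)"
proof -
  interpret \<iota>: group_hom G G "inner_aut G y"
    by (rule aut_group_hom[OF inner_aut_closed[OF assms(2)]])
  have x: "x \<in> carrier G" using assms(1) by (simp add: p'_element_def)
  have conj: "inner_aut G y x = y \<otimes> x \<otimes> inv y" using x by (simp add: inner_aut_def)
  have "inner_aut G y x [^] ord x = inner_aut G y (x [^] ord x)"
    by (rule \<iota>.hom_nat_pow[OF x, symmetric])
  also have "\<dots> = \<one>" by (simp only: pow_ord_eq_1[OF x] \<iota>.hom_one)
  finally have "ord (y \<otimes> x \<otimes> inv y) dvd ord x"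
    unfolding conj[symmetric] using pow_eq_id[OF \<iota>.hom_closed[OF x]] by blast
  moreover have "coprime (ord x) p" using assms(1) by (simp add: p'_element_def)
  ultimately have "coprime (ord (y \<otimes> x \<otimes> inv y)) p" by (rule coprime_divisors[OF _ dvd_refl])
  then show ?thesis using x assms(2) by (simp add: p'_element_def)
qed

text \<open>Invariance holds because the $p'$-elements form a union of conjugacy classes.\<close>

lemma characteristic_fixed_by_p'_automorphisms:
  "characteristic {x \<in> carrier G. \<forall>\<alpha>. p'_element p (AutoGroup G) \<alpha> \<longrightarrow> \<alpha> x = x} G"
    (is "characteristic ?H G")
  unfolding characteristic_def
proof (intro conjI ballI)
  interpret A: group "AutoGroup G" by (rule AutoGroup)
  have hom: "group_hom G G \<alpha>" if "p'_element p (AutoGroup G) \<alpha>" for \<alpha>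
    using that aut_group_hom by (simp add: p'_element_def)
  show "subgroup ?H G"
  proof (rule subgroupI)
    show "?H \<subseteq> carrier G" by auto
    have "\<one> \<in> ?H" by (auto simp: group_hom.hom_one[OF hom])
    then show "?H \<noteq> {}" by blast
  next
    fix x assume x: "x \<in> ?H"
    have "\<alpha> (inv x) = inv x" if \<alpha>: "p'_element p (AutoGroup G) \<alpha>" for \<alpha>
    proof -
      have "\<alpha> x = x" using x \<alpha> by blast
      then show ?thesis using group_hom.hom_inv[OF hom[OF \<alpha>], of x] x by simp
    qed
    then show "inv x \<in> ?H" using x by simp
  next
    fix x y assume x: "x \<in> ?H" and y: "y \<in> ?H"
    have "\<alpha> (x \<otimes> y) = x \<otimes> y" if \<alpha>: "p'_element p (AutoGroup G) \<alpha>" for \<alpha>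
    proof -
      have "\<alpha> x = x" "\<alpha> y = y" using x y \<alpha> by blast+
      then show ?thesis using group_hom.hom_mult[OF hom[OF \<alpha>], of x y] x y by simp
    qed
    then show "x \<otimes> y \<in> ?H" using x y by simp
  qed
  fix \<beta> x assume \<beta>: "\<beta> \<in> carrier (AutoGroup G)" and x: "x \<in> ?H"
  have "\<alpha> (\<beta> x) = \<beta> x" if \<alpha>: "p'_element p (AutoGroup G) \<alpha>" for \<alpha>
  proof -
    let ?\<gamma> = "inv\<^bsub>AutoGroup G\<^esub> \<beta> \<otimes>\<^bsub>AutoGroup G\<^esub> \<alpha> \<otimes>\<^bsub>AutoGroup G\<^esub> \<beta>"
    have \<alpha>A: "\<alpha> \<in> carrier (AutoGroup G)" using \<alpha> by (simp add: p'_element_def)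
    have "p'_element p (AutoGroup G) ?\<gamma>"
      using A.p'_element_conjugate[OF \<alpha> A.inv_closed[OF \<beta>]] \<beta> by simp
    then have "?\<gamma> x = x" using x by blast
    moreover have "?\<gamma> x = (inv\<^bsub>AutoGroup G\<^esub> \<beta>) (\<alpha> (\<beta> x))"
      using \<alpha>A \<beta> x by (simp add: AutoGroup_apply aut_closed)
    ultimately have "(inv\<^bsub>AutoGroup G\<^esub> \<beta>) (\<alpha> (\<beta> x)) = x" by simp
    then have "\<beta> x = \<beta> ((inv\<^bsub>AutoGroup G\<^esub> \<beta>) (\<alpha> (\<beta> x)))" by simp
    also have "\<dots> = \<alpha> (\<beta> x)" using \<alpha>A \<beta> x by (simp add: aut_inv_apply aut_closed)
    finally show ?thesis by simp
  qed
  then show "\<beta> x \<in> ?H" using x \<beta> by (simp add: aut_closed)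
qed

lemma characteristic_Int:
  "characteristic H G \<Longrightarrow> characteristic K G \<Longrightarrow> characteristic (H \<inter> K) G"
  by (simp add: characteristic_def subgroups_Inter_pair)

text \<open>
  Counting the cosets of $N$ in $H$ instead of treating $g$ directly avoids showing that the
  $p$-elements of $H$ form a subgroup: it is enough that the index is coprime to $p$.
\<close>

lemma fixed_by_p'_automorphisms_imp_absolute_hypercenter:
  assumes fin: "finite (carrier G)" and p: "Factorial_Ring.prime p"
    and g: "g \<in> carrier G" "g [^] ((p::nat) ^ k) = \<one>"
    and fixed: "\<And>\<alpha>. p'_element p (AutoGroup G) \<alpha> \<Longrightarrow> \<alpha> g = g"
  shows "g \<in> absolute_hypercenter G"
proof -
  define H where "H = {x \<in> carrier G. \<forall>\<alpha>. p'_element p (AutoGroup G) \<alpha> \<longrightarrow> \<alpha> x = x}"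
  define N where "N = absolute_hypercenter G \<inter> H"
  define E where "E = rcosets\<^bsub>G\<lparr>carrier := H\<rparr>\<^esub> N"
  define \<phi> :: "('a \<Rightarrow> 'a) \<Rightarrow> 'a set \<Rightarrow> 'a set" where "\<phi> = (\<lambda>\<alpha>. \<lambda>C\<in>E. \<alpha> ` C)"
  have H: "characteristic H G"
    unfolding H_def by (rule characteristic_fixed_by_p'_automorphisms)
  have L: "characteristic (absolute_hypercenter G) G"
    unfolding absolute_hypercenter_def by (rule characteristic_absolute_center)
  have N: "characteristic N G"
    unfolding N_def by (rule characteristic_Int[OF L H])
  interpret H: subgroup H G using H by (simp add: characteristic_def)
  interpret N: normal N G by (rule characteristic_imp_normal[OF N])
  interpret HN: normal N "G\<lparr>carrier := H\<rparr>"
    unfolding N_def using normal_Int_subgroup[OF H.subgroup_axioms characteristic_imp_normal[OF L]] .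
  interpret act: group_action "AutoGroup G" E \<phi>
    unfolding E_def \<phi>_def by (rule aut_action_on_cosets[OF H N])
  have E: "C \<in> E \<longleftrightarrow> (\<exists>h\<in>H. C = N #> h)" for C
    unfolding E_def RCOSETS_def r_coset_def by simp
  have "E = (\<lambda>h. N #> h) ` H" using E by (simp add: set_eq_iff image_iff)
  then have finE: "finite E" using finite_subset[OF H.subset fin] by simp
  have \<phi>: "\<phi> \<alpha> (N #> h) = N #> \<alpha> h" if "\<alpha> \<in> carrier (AutoGroup G)" "h \<in> H" for \<alpha> h
    using aut_image_coset[OF N that(1) H.mem_carrier[OF that(2)]] E that(2) by (auto simp: \<phi>_def)
  have NE: "N \<in> E" unfolding E by (rule bexI[of _ \<one>]) (simp_all only: coset_mult_one[OF N.subset] H.one_closed)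
  have "p dvd card {C \<in> E. \<exists>\<alpha>\<in>carrier (AutoGroup G). \<phi> \<alpha> C \<noteq> C}"
  proof (rule act.dvd_card_non_fixed_points[OF finite_AutoGroup[OF fin] finE p])
    fix \<alpha> C assume \<alpha>: "p'_element p (AutoGroup G) \<alpha>" and C: "C \<in> E"
    from C[unfolded E] obtain h where h: "h \<in> H" "C = N #> h" by (rule bexE)
    have "\<alpha> \<in> carrier (AutoGroup G)" using \<alpha> by (simp add: p'_element_def)
    moreover have "\<alpha> h = h" using \<alpha> h(1) unfolding H_def by blast
    ultimately show "\<phi> \<alpha> C = C" using \<phi>[OF _ h(1)] h(2) by simp
  qed
  also have "{C \<in> E. \<exists>\<alpha>\<in>carrier (AutoGroup G). \<phi> \<alpha> C \<noteq> C} = E - {N}"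
  proof (intro equalityI subsetI)
    fix C assume C: "C \<in> {C \<in> E. \<exists>\<alpha>\<in>carrier (AutoGroup G). \<phi> \<alpha> C \<noteq> C}"
    have "\<phi> \<alpha> N = N" if \<alpha>: "\<alpha> \<in> carrier (AutoGroup G)" for \<alpha>
      using \<phi>[OF \<alpha> H.one_closed] group_hom.hom_one[OF aut_group_hom[OF \<alpha>]]
      by (simp add: coset_mult_one N.subset)
    with C show "C \<in> E - {N}" by blast
  next
    fix C assume C: "C \<in> E - {N}"
    then have "C \<in> E" by blast
    from this[unfolded E] obtain h where h: "h \<in> H" "C = N #> h" by (rule bexE)
    show "C \<in> {C \<in> E. \<exists>\<alpha>\<in>carrier (AutoGroup G). \<phi> \<alpha> C \<noteq> C}"
    proof (rule ccontr)
      assume "C \<notin> {C \<in> E. \<exists>\<alpha>\<in>carrier (AutoGroup G). \<phi> \<alpha> C \<noteq> C}"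
      then have coset: "N #> \<alpha> h = N #> h" if "\<alpha> \<in> carrier (AutoGroup G)" for \<alpha>
        using that C h(2) \<phi>[OF that h(1)] by simp
      have hG: "h \<in> carrier G" using h(1) by (rule H.mem_carrier)
      have "aut_commutator G h \<alpha> \<in> absolute_hypercenter G"
        if \<alpha>: "\<alpha> \<in> carrier (AutoGroup G)" for \<alpha>
      proof -
        have \<alpha>h: "\<alpha> h \<in> carrier G" using \<alpha> hG by (rule aut_closed)
        have "N #> (\<alpha> h \<otimes> inv h) = N"
          by (rule coset_mult_inv2[OF coset[OF \<alpha>] \<alpha>h hG N.subset])
        then have "\<alpha> h \<otimes> inv h \<in> N"
          using \<alpha>h hG by (intro coset_join1[OF _ _ N.subgroup_axioms]) auto
        then have "inv h \<otimes> (\<alpha> h \<otimes> inv h) \<otimes> h \<in> N" by (rule N.inv_op_closed1[OF hG])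
        then have "aut_commutator G h \<alpha> \<in> N"
          using \<alpha>h hG by (simp add: aut_commutator_def m_assoc)
        then show ?thesis by (simp add: N_def)
      qed
      then have "h \<in> absolute_hypercenter G"
        by (rule absolute_hypercenter_fixpoint[OF fin hG])
      then have "h \<in> N" using h(1) by (simp add: N_def)
      then have "C = N" unfolding h(2) by (rule N.rcos_const[OF is_group])
      with C show False by simp
    qed
  qed
  finally have "p dvd card E - 1" using NE finE by simp
  moreover have "card E > 0" using NE finE by (auto simp: card_gt_0_iff)
  ultimately have "\<not> p dvd card E"
    using dvd_diffD1[of p "card E" 1] prime_gt_1_nat[OF p] by auto
  then have "coprime (p ^ k) (card E)" using prime_imp_coprime[OF p] by simp
  moreover have "g \<in> H" using g(1) fixed unfolding H_def by blast
  moreover have "g [^]\<^bsub>G\<lparr>carrier := H\<rparr>\<^esub> (p ^ k) = \<one>\<^bsub>G\<lparr>carrier := H\<rparr>\<^esub>"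
    using g(2) by (simp add: nat_pow_consistent[symmetric])
  ultimately have "g \<in> N"
    using finite_subset[OF H.subset fin] unfolding E_def
    by (intro HN.mem_if_coprime_index[of g "p ^ k"]) auto
  then show ?thesis by (simp add: N_def)
qed

end

theorem theorem1p3:
  fixes p :: nat and G :: "('a, 'b) monoid_scheme" and g :: 'a
  assumes "Factorial_Ring.prime p"
    and "group G"
    and "finite (carrier G)"
    and "p_element p G g"
  shows "g \<in> absolute_hypercenter G \<longleftrightarrow>
    (\<forall>\<alpha>. p'_element p (AutoGroup G) \<alpha> \<longrightarrow> \<alpha> g = g)"
proof -
  interpret group G by fact
  interpret A: group "AutoGroup G" by (rule AutoGroup)
  obtain k where g: "g \<in> carrier G" "ord g = p ^ k" using assms(4) by (auto simp: p_element_def)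
  then have gk: "g [^]\<^bsub>G\<^esub> (p ^ k) = \<one>\<^bsub>G\<^esub>" using pow_ord_eq_1[OF g(1)] by simp
  show ?thesis
  proof (intro iffI allI impI)
    fix \<alpha> assume gL: "g \<in> absolute_hypercenter G" and \<alpha>: "p'_element p (AutoGroup G) \<alpha>"
    then have \<alpha>A: "\<alpha> \<in> carrier (AutoGroup G)" and cop: "coprime (p ^ k) (A.ord \<alpha>)"
      by (auto simp: p'_element_def coprime_commute)
    have "coprime_automorphisms_fix G (absolute_hypercenter G)"
      unfolding absolute_hypercenter_def
      by (rule coprime_automorphisms_fix_absolute_center[OF assms(3)])
    then show "\<alpha> g = g"
      using gL \<alpha>A cop gk A.pow_ord_eq_1[OF \<alpha>A]
      unfolding coprime_automorphisms_fix_def by blast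
  next
    assume "\<forall>\<alpha>. p'_element p (AutoGroup G) \<alpha> \<longrightarrow> \<alpha> g = g"
    then show "g \<in> absolute_hypercenter G"
      using fixed_by_p'_automorphisms_imp_absolute_hypercenter[OF assms(3,1) g(1) gk] by blast
  qed
qed

end
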